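(* Let $(\mu_t,T_t)$ and $(\mu'_t,T'_t)$ be two equivalent formal one-parameter deformations of a Rota-Baxter Leibniz algebra $(\mathfrak{g}_T,\mu)$. Then their infinitesimals $(\mu_1,T_1)$ and $(\mu'_1,T'_1)$ are in the same cohomology class in $H^2_{RBLA}(\mathfrak{g},\mathfrak{g})$.
   Context: All vector spaces are over a fixed field $\mathbb{K}$. A (left) Leibniz algebra is a vector space $\mathfrak{g}$ with a bilinear bracket $\mu=[\,,\,]_{\mathfrak{g}}$ satisfying $[x,[y,z]_{\mathfrak{g}}]_{\mathfrak{g}}=[[x,y]_{\mathfrak{g}},z]_{\mathfrak{g}}+[y,[x,z]_{\mathfrak{g}}]_{\mathfrak{g}}$. A Rota-Baxter operator is a linear map $T:\mathfrak{g}\to\mathfrak{g}$ with $[T(x),T(y)]_{\mathfrak{g}}=T([T(x),y]_{\mathfrak{g}}+[x,T(y)]_{\mathfrak{g}})$. A Rota-Baxter Leibniz algebra $(\mathfrak{g}_T,\mu)$ is a Leibniz algebra together with a Rota-Baxter operator $T$. Cohomology of $(\mathfrak{g}_T,\mu)$ with coefficients in itself. Put $C^n_{LA}(\mathfrak{g},\mathfrak{g})=C^n_{RBO}(\mathfrak{g},\mathfrak{g})=\mathrm{Hom}(\mathfrak{g}^{\otimes n},\mathfrak{g})$, $n\ge0$. For bilinear maps $l,r:\mathfrak{g}\times\mathfrak{g}\to\mathfrak{g}$ and a bracket $[\,,\,]$ on $\mathfrak{g}$ consider the formula $$\begin{aligned}&\sum_{i=1}^{n}(-1)^{i+1}l(x_i,f(x_1,\dots,\widehat{x_i},\dots,x_{n+1}))+(-1)^{n+1}r(f(x_1,\dots,x_n),x_{n+1})\\&+\sum_{1\le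 i<j\le n+1}(-1)^i f(x_1,\dots,\widehat{x_i},\dots,x_{j-1},[x_i,x_j],x_{j+1},\dots,x_{n+1}).\end{aligned}$$ $(\delta^nf)(x_1,\dots,x_{n+1})$ is this expression with $l(x,u)=[x,u]_{\mathfrak{g}}$, $r(u,x)=[u,x]_{\mathfrak{g}}$ and bracket $[\,,\,]_{\mathfrak{g}}$; $(\partial^nf)(x_1,\dots,x_{n+1})$ is this expression with $l(x,u)=[T(x),u]_{\mathfrak{g}}-T([x,u]_{\mathfrak{g}})$, $r(u,x)=[u,T(x)]_{\mathfrak{g}}-T([u,x]_{\mathfrak{g}})$ and bracket $[x,y]_*=[x,T(y)]_{\mathfrak{g}}+[T(x),y]_{\mathfrak{g}}$. Also $$\phi^n(f)(x_1,\dots,x_n)=f(Tx_1,\dots,Tx_n)-\sum_{i=1}^n T\big(f(Tx_1,\dots,Tx_{i-1},x_i,Tx_{i+1},\dots,Tx_n)\big).$$ For $n\ge1$, $C^n_{RBLA}(\mathfrak{g},\mathfrak{g})=C^n_{LA}(\mathfrak{g},\mathfrak{g})\oplus C^{n-1}_{RBO}(\mathfrak{g},\mathfrak{g})$ and $d^n(\alpha,\beta)=(\delta^n(\alpha),-\partial^{n-1}(\beta)-\phi^n(\alpha))$. $H^2_{RBLA}(\mathfrak{g},\mathfrak{g})=\ker d^2/\operatorname{im} d^1$. A formal one-parameter deformation of $(\mathfrak{g}_T,\mu)$ is a pair of power series $\mu_t=\sum_{i\ge0}\mu_it^i$, $T_t=\sum_{i\ge0}T_it^i$ with $\mu_i:\mathfrak{g}\otimes\mathfrak{g}\to\mathfrak{g}$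 and $T_i:\mathfrak{g}\to\mathfrak{g}$ linear, $(\mu_0,T_0)=(\mu,T)$, such that (extending $\mathbb{K}[[t]]$-linearly) $(\mathfrak{g}[[t]]_{T_t},\mu_t)$ is a Rota-Baxter Leibniz algebra. Its infinitesimal is the pair $(\mu_1,T_1)$. Two deformations $(\mu_t,T_t)$, $(\mu'_t,T'_t)$ are equivalent if there is a formal isomorphism $\psi_t=\sum_{i\ge0}\psi_it^i:\mathfrak{g}[[t]]\to\mathfrak{g}[[t]]$, with $\psi_i:\mathfrak{g}\to\mathfrak{g}$ linear and $\psi_0=\mathrm{id}_{\mathfrak{g}}$, such that $\psi_t\circ\mu'_t=\mu_t\circ(\psi_t\otimes\psi_t)$ and $\psi_t\circ T'_t=T_t\circ\psi_t$. *)

theory Defs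
  imports
    "HOL-Computational_Algebra.Formal_Power_Series"
    "HOL-Library.Function_Algebras"
    "HOL-Library.Product_Plus"
begin

section \<open>Rota-Baxter Leibniz algebras\<close>

text \<open>
  The algebras are defined over a commutative ring, because both the \<open>\<K>\<close>-vector space
  \<open>\<gg>\<close> and the \<open>\<K>[[t]]\<close>-module \<open>\<gg>[[t]]\<close> have to carry such a structure.
  Over a field, \<^const>\<open>module\<close> and \<^const>\<open>module_hom\<close> coincide with
  \<^const>\<open>vector_space\<close> and \<^const>\<open>Vector_Spaces.linear\<close>.
\<close>

definition bilinear_map ::
  "('k::comm_ring_1 \<Rightarrow> 'g::ab_group_add \<Rightarrow> 'g) \<Rightarrow> ('g \<Rightarrow> 'g \<Rightarrow> 'g) \<Rightarrow> bool" where
  "bilinear_map s b \<longleftrightarrow>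
     (\<forall>x. module_hom s s (\<lambda>y. b x y)) \<and> (\<forall>y. module_hom s s (\<lambda>x. b x y))"

locale leibniz_algebra = module s
  for s :: "'k::comm_ring_1 \<Rightarrow> 'g::ab_group_add \<Rightarrow> 'g" +
  fixes br :: "'g \<Rightarrow> 'g \<Rightarrow> 'g"
  assumes bilinear_br: "bilinear_map s br"
    and leibniz: "br x (br y z) = br (br x y) z + br y (br x z)"

locale rota_baxter_leibniz_algebra = leibniz_algebra s br
  for s :: "'k::comm_ring_1 \<Rightarrow> 'g::ab_group_add \<Rightarrow> 'g" and br :: "'g \<Rightarrow> 'g \<Rightarrow> 'g" +
  fixes T :: "'g \<Rightarrow> 'g"
  assumes linear_T: "module_hom s s T"
    and rota_baxter: "br (T x) (T y) = T (br (T x) y + br x (T y))"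


section \<open>Cohomology with coefficients in the algebra itself\<close>

text \<open>
  An element of \<open>Hom(\<gg>\<^sup>\<otimes>\<^sup>n, \<gg>)\<close> is represented as an \<open>n\<close>-multilinear function on lists of
  length \<open>n\<close>, extended by \<open>0\<close> to lists of any other length so that equality, zero and the
  group operations on cochains are those of functions. Lists are indexed from \<open>0\<close>, which
  shifts the exponents \<open>i + 1\<close> and \<open>i\<close> of the usual \<open>1\<close>-based formulas by one.
\<close>

definition multilinear_maps ::
  "('k::comm_ring_1 \<Rightarrow> 'g::ab_group_add \<Rightarrow> 'g) \<Rightarrow> nat \<Rightarrow> ('g list \<Rightarrow> 'g) set" where
  "multilinear_maps s n =
     {f. (\<forall>xs. length xs \<noteq> n \<longrightarrow> f xs = 0) \<and>
         (\<forall>xs i. length xs = n \<longrightarrow> i < n \<longrightarrow> module_hom s s (\<lambda>u. f (xs[i := u])))}"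

definition remove_nth :: "nat \<Rightarrow> 'a list \<Rightarrow> 'a list" where
  "remove_nth i xs = take i xs @ drop (Suc i) xs"

text \<open>The common formula behind both differentials, for a left action \<open>l\<close>, a right
  action \<open>r\<close> and a bracket \<open>b\<close>.\<close>

definition coboundary_formula ::
  "('k::comm_ring_1 \<Rightarrow> 'g::ab_group_add \<Rightarrow> 'g) \<Rightarrow> ('g \<Rightarrow> 'g \<Rightarrow> 'g) \<Rightarrow> ('g \<Rightarrow> 'g \<Rightarrow> 'g) \<Rightarrow>
     ('g \<Rightarrow> 'g \<Rightarrow> 'g) \<Rightarrow> nat \<Rightarrow> ('g list \<Rightarrow> 'g) \<Rightarrow> 'g list \<Rightarrow> 'g" where
  "coboundary_formula s l r b n f = (\<lambda>xs. if length xs = n + 1 then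
       (\<Sum>i<n. s ((-1) ^ i) (l (xs ! i) (f (remove_nth i xs))))
     + s ((-1) ^ (n + 1)) (r (f (take n xs)) (xs ! n))
     + (\<Sum>j\<le>n. \<Sum>i<j. s ((-1) ^ (i + 1)) (f (remove_nth i (xs[j := b (xs ! i) (xs ! j)]))))
     else 0)"

context rota_baxter_leibniz_algebra
begin

text \<open>\<open>\<delta>\<^sup>n\<close>\<close>
definition delta :: "nat \<Rightarrow> ('g list \<Rightarrow> 'g) \<Rightarrow> 'g list \<Rightarrow> 'g" where
  "delta = coboundary_formula s br br br"

text \<open>\<open>\<partial>\<^sup>n\<close>\<close>
definition rb_delta :: "nat \<Rightarrow> ('g list \<Rightarrow> 'g) \<Rightarrow> 'g list \<Rightarrow> 'g" where
  "rb_delta = coboundary_formula s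
     (\<lambda>x u. br (T x) u - T (br x u))
     (\<lambda>u x. br u (T x) - T (br u x))
     (\<lambda>x y. br x (T y) + br (T x) y)"

text \<open>\<open>\<phi>\<^sup>n\<close>\<close>
definition phi :: "nat \<Rightarrow> ('g list \<Rightarrow> 'g) \<Rightarrow> 'g list \<Rightarrow> 'g" where
  "phi n f = (\<lambda>xs. if length xs = n then
       f (map T xs) - (\<Sum>i<n. T (f ((map T xs)[i := xs ! i])))
     else 0)"

text \<open>\<open>C\<^sup>n\<close> and \<open>d\<^sup>n\<close> are meaningful for \<open>n \<ge> 1\<close> only.\<close>

definition cochains :: "nat \<Rightarrow> (('g list \<Rightarrow> 'g) \<times> ('g list \<Rightarrow> 'g)) set" where
  "cochains n = multilinear_maps s n \<times> multilinear_maps s (n - 1)"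

definition d ::
  "nat \<Rightarrow> ('g list \<Rightarrow> 'g) \<times> ('g list \<Rightarrow> 'g) \<Rightarrow> ('g list \<Rightarrow> 'g) \<times> ('g list \<Rightarrow> 'g)" where
  "d n = (\<lambda>(\<alpha>, \<beta>). (delta n \<alpha>, - rb_delta (n - 1) \<beta> - phi n \<alpha>))"

definition Z2 :: "(('g list \<Rightarrow> 'g) \<times> ('g list \<Rightarrow> 'g)) set" where
  "Z2 = {c \<in> cochains 2. d 2 c = 0}"

definition B2 :: "(('g list \<Rightarrow> 'g) \<times> ('g list \<Rightarrow> 'g)) set" where
  "B2 = d 1 ` cochains 1"

text \<open>The elements of \<open>H\<^sup>2\<close> are the cohomology classes, as sets of cocycles.\<close>
definition H2 :: "(('g list \<Rightarrow> 'g) \<times> ('g list \<Rightarrow> 'g)) set set" where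
  "H2 = Z2 // {(c, c'). c \<in> Z2 \<and> c' \<in> Z2 \<and> c - c' \<in> B2}"

end


section \<open>Formal one-parameter deformations\<close>

context includes fps_syntax
begin

text \<open>The type \<open>'g fps\<close> is \<open>\<gg>[[t]]\<close>; this is its \<open>\<K>[[t]]\<close>-module structure.\<close>
definition fps_scale ::
  "('k::comm_ring_1 \<Rightarrow> 'g::ab_group_add \<Rightarrow> 'g) \<Rightarrow> 'k fps \<Rightarrow> 'g fps \<Rightarrow> 'g fps" where
  "fps_scale s c x = Abs_fps (\<lambda>n. \<Sum>i\<le>n. s (c $ i) (x $ (n - i)))"

text \<open>The action on \<open>\<gg>[[t]]\<close> of power series whose coefficients are linear, respectively
  bilinear, maps on \<open>\<gg>\<close>.\<close>

definition fps_ext1 :: "('g::ab_group_add \<Rightarrow> 'g) fps \<Rightarrow> 'g fps \<Rightarrow> 'g fps" where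
  "fps_ext1 F x = Abs_fps (\<lambda>n. \<Sum>i\<le>n. (F $ i) (x $ (n - i)))"

definition fps_ext2 :: "('g::ab_group_add \<Rightarrow> 'g \<Rightarrow> 'g) fps \<Rightarrow> 'g fps \<Rightarrow> 'g fps \<Rightarrow> 'g fps" where
  "fps_ext2 B x y = Abs_fps (\<lambda>n. \<Sum>i\<le>n. \<Sum>j\<le>n - i. (B $ i) (x $ j) (y $ (n - i - j)))"

definition formal_deformation ::
  "('k::comm_ring_1 \<Rightarrow> 'g::ab_group_add \<Rightarrow> 'g) \<Rightarrow> ('g \<Rightarrow> 'g \<Rightarrow> 'g) \<Rightarrow> ('g \<Rightarrow> 'g) \<Rightarrow>
     ('g \<Rightarrow> 'g \<Rightarrow> 'g) fps \<Rightarrow> ('g \<Rightarrow> 'g) fps \<Rightarrow> bool" where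
  "formal_deformation s \<mu> T \<mu>t Tt \<longleftrightarrow>
     (\<forall>i. bilinear_map s (\<mu>t $ i)) \<and> (\<forall>i. module_hom s s (Tt $ i)) \<and>
     \<mu>t $ 0 = \<mu> \<and> Tt $ 0 = T \<and>
     rota_baxter_leibniz_algebra (fps_scale s) (fps_ext2 \<mu>t) (fps_ext1 Tt)"

text \<open>Bijectivity of \<open>\<psi>\<^sub>t\<close> is automatic from \<open>\<psi>\<^sub>0 = id\<close>; it is kept because the notion
  asks for an isomorphism.\<close>
definition equivalent_deformations ::
  "('k::comm_ring_1 \<Rightarrow> 'g::ab_group_add \<Rightarrow> 'g) \<Rightarrow>
     ('g \<Rightarrow> 'g \<Rightarrow> 'g) fps \<Rightarrow> ('g \<Rightarrow> 'g) fps \<Rightarrow>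
     ('g \<Rightarrow> 'g \<Rightarrow> 'g) fps \<Rightarrow> ('g \<Rightarrow> 'g) fps \<Rightarrow> bool" where
  "equivalent_deformations s \<mu>t Tt \<mu>t' Tt' \<longleftrightarrow>
     (\<exists>\<psi>. (\<forall>i. module_hom s s (\<psi> $ i)) \<and> \<psi> $ 0 = id \<and> bij (fps_ext1 \<psi>) \<and>
        (\<forall>x y. fps_ext1 \<psi> (fps_ext2 \<mu>t' x y) = fps_ext2 \<mu>t (fps_ext1 \<psi> x) (fps_ext1 \<psi> y)) \<and>
        (\<forall>x. fps_ext1 \<psi> (fps_ext1 Tt' x) = fps_ext1 Tt (fps_ext1 \<psi> x)))"

text \<open>The pair \<open>(\<mu>\<^sub>1, T\<^sub>1)\<close>, in the list encoding of cochains.\<close>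
definition infinitesimal ::
  "('g::ab_group_add \<Rightarrow> 'g \<Rightarrow> 'g) fps \<Rightarrow> ('g \<Rightarrow> 'g) fps \<Rightarrow> ('g list \<Rightarrow> 'g) \<times> ('g list \<Rightarrow> 'g)" where
  "infinitesimal \<mu>t Tt =
     (\<lambda>xs. if length xs = 2 then (\<mu>t $ 1) (xs ! 0) (xs ! 1) else 0,
      \<lambda>xs. if length xs = 1 then (Tt $ 1) (xs ! 0) else 0)"

end

end

theory Submission
  imports Defs
begin

text \<open>
  Everything is read off from the coefficient of \<open>t\<close> in the defining identities, evaluated at
  constant power series. In the Leibniz and Rota-Baxter identities of \<open>(\<mu>\<^sub>t, T\<^sub>t)\<close> it gives
  \<open>d\<^sup>2(\<mu>\<^sub>1, T\<^sub>1) = 0\<close>, and in the two equations of an equivalence \<open>\<psi>\<^sub>t\<close> it gives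
  \<open>(\<mu>'\<^sub>1, T'\<^sub>1) - (\<mu>\<^sub>1, T\<^sub>1) = d\<^sup>1(\<psi>\<^sub>1, 0)\<close>.
\<close>

unbundle fps_syntax

lemma bilinear_mapD:
  assumes "bilinear_map s b"
  shows bilinear_map_add_left: "b (x + x') y = b x y + b x' y"
    and bilinear_map_add_right: "b x (y + y') = b x y + b x y'"
    and bilinear_map_zero_left: "b 0 y = 0"
    and bilinear_map_zero_right: "b x 0 = 0"
    and bilinear_map_minus_left: "b (- x) y = - b x y"
    and bilinear_map_minus_right: "b x (- y) = - b x y"
proof -
  interpret l: module_hom s s "\<lambda>x. b x y"
    using assms by (simp add: bilinear_map_def)
  interpret r: module_hom s s "\<lambda>y. b x y"
    using assms by (simp add: bilinear_map_def)
  show "b (x + x') y = b x y + b x' y" "b 0 y = 0" "b (- x) y = - b x y"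
    by (fact l.add l.zero l.neg)+
  show "b x (y + y') = b x y + b x y'" "b x 0 = 0" "b x (- y) = - b x y"
    by (fact r.add r.zero r.neg)+
qed

lemma fps_ext1_nth_0: "fps_ext1 F x $ 0 = (F $ 0) (x $ 0)"
  by (simp add: fps_ext1_def)

text \<open>The index is written \<open>Suc 0\<close> because simp rewrites \<open>1\<close> to it
  before a rule could match. The degree in \<open>coboundary_formula_1\<close> and
  \<open>phi_1\<close> is unfolded below for the same reason.\<close>

lemma fps_ext1_nth_1: "fps_ext1 F x $ Suc 0 = (F $ 0) (x $ 1) + (F $ 1) (x $ 0)"
  by (simp add: fps_ext1_def)

lemma fps_ext2_nth_0: "fps_ext2 B x y $ 0 = (B $ 0) (x $ 0) (y $ 0)"
  by (simp add: fps_ext2_def)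

lemma fps_ext2_nth_1:
  "fps_ext2 B x y $ Suc 0 =
     (B $ 0) (x $ 0) (y $ 1) + (B $ 0) (x $ 1) (y $ 0) + (B $ 1) (x $ 0) (y $ 0)"
  by (simp add: fps_ext2_def)

lemmas fps_ext_nth = fps_ext1_nth_0 fps_ext1_nth_1 fps_ext2_nth_0 fps_ext2_nth_1

lemma zero_multilinear_maps:
  assumes "module s"
  shows "0 \<in> multilinear_maps s n"
proof -
  interpret module_pair s s
    using assms by (simp add: module_pair_def)
  show ?thesis
    by (simp add: multilinear_maps_def module_hom_zero)
qed

lemma multilinear_maps_1I:
  assumes "module_hom s s f"
  shows "(\<lambda>xs. if length xs = 1 then f (xs ! 0) else 0) \<in> multilinear_maps s 1"
  using assms by (simp add: multilinear_maps_def)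

lemma multilinear_maps_2I:
  assumes "bilinear_map s b"
  shows "(\<lambda>xs. if length xs = 2 then b (xs ! 0) (xs ! 1) else 0) \<in> multilinear_maps s 2"
  using assms by (auto simp: multilinear_maps_def bilinear_map_def less_2_cases_iff)

lemma length_eq_2_iff: "length xs = 2 \<longleftrightarrow> (\<exists>x y. xs = [x, y])"
  by (auto simp: numeral_2_eq_2 length_Suc_conv)

context rota_baxter_leibniz_algebra
begin

lemmas br_simps = bilinear_mapD[OF bilinear_br]

lemma T_simps: "T (x + y) = T x + T y" "T 0 = 0" "T (- x) = - T x"
proof -
  interpret T: module_hom s s T by (fact linear_T)
  show "T (x + y) = T x + T y" "T 0 = 0" "T (- x) = - T x"
    by (fact T.add T.zero T.neg)+
qed

text \<open>\<open>l\<close>, \<open>r\<close> and \<open>b\<close> stay arbitrary so that one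
  expansion serves both \<open>rb_delta 1\<close>, applied to T_1, and \<open>delta 1\<close>,
  applied to -psi_1.\<close>

lemma coboundary_formula_1:
  "coboundary_formula s l r b 1 f [x, y] = l x (f [y]) + r (f [x]) y - f [b x y]"
  by (simp add: coboundary_formula_def remove_nth_def)

text \<open>With \<open>br\<close> for \<open>l\<close>, \<open>r\<close> and \<open>b\<close> and f
  bilinear, this is the t-coefficient of [x,[y,z]] - [[x,y],z] - [y,[x,z]] for the bracket
  \<open>br\<close> + t f.\<close>

lemma coboundary_formula_2:
  "coboundary_formula s l r b 2 f [x, y, z] =
     l x (f [y, z]) - l y (f [x, z]) - r (f [x, y]) z
     - f [b x y, z] - f [y, b x z] + f [x, b y z]"
  by (simp add: coboundary_formula_def remove_nth_def numeral_2_eq_2)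

lemma phi_1: "phi 1 f [x] = f [T x] - T (f [x])"
  by (simp add: phi_def)

lemma phi_2: "phi 2 f [x, y] = f [T x, T y] - T (f [x, T y]) - T (f [T x, y])"
  by (simp add: phi_def numeral_2_eq_2 algebra_simps)

lemma infinitesimal_in_Z2:
  assumes "formal_deformation s br T \<mu>t Tt"
  shows "infinitesimal \<mu>t Tt \<in> Z2"
proof -
  have bil: "bilinear_map s (\<mu>t $ i)" and lin: "module_hom s s (Tt $ i)" for i
    using assms by (auto simp: formal_deformation_def)
  have zero: "\<mu>t $ 0 = br" "Tt $ 0 = T"
    using assms by (auto simp: formal_deformation_def)
  interpret deformed: rota_baxter_leibniz_algebra "fps_scale s" "fps_ext2 \<mu>t" "fps_ext1 Tt"
    using assms by (simp add: formal_deformation_def)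
  interpret T1: module_hom s s "Tt $ Suc 0" by (fact lin)
  note lin_simps = br_simps T_simps bilinear_mapD[OF bil] T1.add
  define m where "m = (\<lambda>xs. if length xs = 2 then (\<mu>t $ 1) (xs ! 0) (xs ! 1) else 0)"
  define t where "t = (\<lambda>xs. if length xs = 1 then (Tt $ 1) (xs ! 0) else 0)"
  have "delta 2 m xs = 0" for xs
  proof (cases "length xs = 3")
    case True
    then obtain x y z where xs: "xs = [x, y, z]"
      by (auto simp: numeral_3_eq_3 length_Suc_conv)
    \<comment> \<open>Constant series have t-coefficient 0, so in the Leibniz identity exactly the
      terms with one mu_1 and one \<open>br\<close> survive. They add up to
      \<open>delta 2 m\<close>.\<close>
    show ?thesis
      using arg_cong[OF deformed.leibniz[of "fps_const x" "fps_const y" "fps_const z"],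
          of "\<lambda>a. a $ 1"]
      by (simp add: xs delta_def coboundary_formula_2 m_def fps_ext_nth zero lin_simps
          algebra_simps)
  qed (simp add: delta_def coboundary_formula_def)
  moreover have "- rb_delta 1 t xs - phi 2 m xs = 0" for xs
  proof (cases "length xs = 2")
    case True
    then obtain x y where xs: "xs = [x, y]"
      by (auto simp: length_eq_2_iff)
    \<comment> \<open>At order t the Rota-Baxter identity has terms with one mu_1, which form
      \<open>phi 2 m\<close>, and terms with one T_1, which form
      \<open>rb_delta 1 t\<close>.\<close>
    have "rb_delta 1 t xs + phi 2 m xs = 0"
      using arg_cong[OF deformed.rota_baxter[of "fps_const x" "fps_const y"], of "\<lambda>a. a $ 1"]
      by (simp add: xs rb_delta_def coboundary_formula_1[unfolded One_nat_def] phi_2 m_def t_def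
          fps_ext_nth zero lin_simps algebra_simps)
    then show ?thesis
      by (simp add: add_eq_0_iff)
  qed (simp add: rb_delta_def coboundary_formula_def phi_def)
  ultimately have "d 2 (m, t) = 0"
    by (simp add: d_def zero_prod_def fun_eq_iff)
  moreover have "(m, t) \<in> cochains 2"
    using multilinear_maps_1I[OF lin] multilinear_maps_2I[OF bil]
    by (simp add: cochains_def m_def t_def)
  ultimately show ?thesis
    by (simp add: Z2_def infinitesimal_def m_def t_def)
qed

lemma infinitesimal_diff_in_B2:
  assumes "formal_deformation s br T \<mu>t Tt" "formal_deformation s br T \<mu>t' Tt'"
    and "equivalent_deformations s \<mu>t Tt \<mu>t' Tt'"
  shows "infinitesimal \<mu>t Tt - infinitesimal \<mu>t' Tt' \<in> B2"
proof -
  have zero: "\<mu>t $ 0 = br" "Tt $ 0 = T" "\<mu>t' $ 0 = br" "Tt' $ 0 = T"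
    using assms by (auto simp: formal_deformation_def)
  have bil: "bilinear_map s (\<mu>t $ i)" for i
    using assms by (auto simp: formal_deformation_def)
  obtain \<psi> where \<psi>_lin: "\<And>i. module_hom s s (\<psi> $ i)" and \<psi>_0: "\<psi> $ 0 = id"
    and \<psi>_\<mu>: "\<And>x y. fps_ext1 \<psi> (fps_ext2 \<mu>t' x y) = fps_ext2 \<mu>t (fps_ext1 \<psi> x) (fps_ext1 \<psi> y)"
    and \<psi>_T: "\<And>x. fps_ext1 \<psi> (fps_ext1 Tt' x) = fps_ext1 Tt (fps_ext1 \<psi> x)"
    using assms(3) by (auto simp: equivalent_deformations_def)
  interpret module_pair s s ..
  \<comment> \<open>The sign is due to the order of the difference, unprimed minus primed, which is
    the one that \<open>H2_classI\<close> takes.\<close>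
  define p where "p = (\<lambda>xs. if length xs = 1 then - (\<psi> $ 1) (xs ! 0) else 0)"
  have "(p, 0) \<in> cochains 1"
    using multilinear_maps_1I[OF module_hom_neg[OF \<psi>_lin]]
      zero_multilinear_maps[OF module_axioms]
    by (simp add: cochains_def p_def)
  moreover have "infinitesimal \<mu>t Tt - infinitesimal \<mu>t' Tt' = d 1 (p, 0)"
  proof -
    \<comment> \<open>As psi_0 = id, the t-coefficient reads mu'_1(x,y) + psi_1[x,y] = mu_1(x,y) +
      [psi_1 x, y] + [x, psi_1 y].\<close>
    have "(\<mu>t $ 1) x y - (\<mu>t' $ 1) x y = delta 1 p [x, y]" for x y
      using arg_cong[OF \<psi>_\<mu>[of "fps_const x" "fps_const y"], of "\<lambda>a. a $ 1"]
      by (simp add: delta_def coboundary_formula_1[unfolded One_nat_def] p_def fps_ext_nth zero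
          \<psi>_0 br_simps bilinear_mapD[OF bil] module_hom.zero[OF \<psi>_lin] algebra_simps)
    \<comment> \<open>Here the t-coefficient is T'_1 + psi_1 T = T_1 + T psi_1.\<close>
    moreover have "(Tt $ 1) x - (Tt' $ 1) x = - phi 1 p [x]" for x
      using arg_cong[OF \<psi>_T[of "fps_const x"], of "\<lambda>a. a $ 1"]
      by (simp add: phi_1[unfolded One_nat_def] p_def fps_ext_nth zero \<psi>_0 T_simps
          module_hom.zero[OF \<psi>_lin] algebra_simps)
    \<comment> \<open>In degree 1 the second entry of \<open>d\<close> involves
      \<open>rb_delta 0\<close>; it vanishes on the chosen 0, which leaves
      \<open>- phi 1 p\<close>.\<close>
    moreover have "rb_delta 0 0 xs = 0" for xs
      by (simp add: rb_delta_def coboundary_formula_def br_simps T_simps)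
    moreover have "delta 1 p xs = 0" if "length xs \<noteq> 2" for xs
      using that by (simp add: delta_def coboundary_formula_def)
    moreover have "phi 1 p xs = 0" if "length xs \<noteq> 1" for xs
      using that by (simp add: phi_def)
    ultimately show ?thesis
      by (auto simp: infinitesimal_def d_def fun_eq_iff length_eq_2_iff length_Suc_conv)
  qed
  ultimately show ?thesis
    by (auto simp: B2_def)
qed

text \<open>The witness is the class of \<open>c\<close>: it contains \<open>c\<close> because 0 is
  the coboundary of (0, 0), and \<open>c'\<close> because \<open>c - c'\<close> is a
  coboundary.\<close>

lemma H2_classI:
  assumes "c \<in> Z2" "c' \<in> Z2" "c - c' \<in> B2"
  shows "\<exists>h \<in> H2. c \<in> h \<and> c' \<in> h"
proof -
  let ?R = "{(c, c'). c \<in> Z2 \<and> c' \<in> Z2 \<and> c - c' \<in> B2}"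
  have "(0, 0) \<in> cochains 1"
    by (simp add: cochains_def zero_multilinear_maps[OF module_axioms])
  moreover have "d 1 (0, 0) = 0"
    by (auto simp: d_def delta_def rb_delta_def phi_def coboundary_formula_def zero_prod_def
        fun_eq_iff br_simps T_simps)
  ultimately have "0 \<in> B2"
    by (force simp: B2_def)
  then have "c \<in> ?R `` {c}" "c' \<in> ?R `` {c}"
    using assms by auto
  moreover have "?R `` {c} \<in> H2"
    unfolding H2_def using assms(1) by (rule quotientI)
  ultimately show ?thesis
    by (intro bexI conjI)
qed

end

theorem theorem5p6:
  fixes scale :: "'k::field \<Rightarrow> 'g::ab_group_add \<Rightarrow> 'g"
    and \<mu> :: "'g \<Rightarrow> 'g \<Rightarrow> 'g" and T :: "'g \<Rightarrow> 'g"
    and \<mu>t \<mu>t' :: "('g \<Rightarrow> 'g \<Rightarrow> 'g) fps" and Tt Tt' :: "('g \<Rightarrow> 'g) fps"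
  assumes "vector_space scale"
    and "rota_baxter_leibniz_algebra scale \<mu> T"
    and "formal_deformation scale \<mu> T \<mu>t Tt"
    and "formal_deformation scale \<mu> T \<mu>t' Tt'"
    and "equivalent_deformations scale \<mu>t Tt \<mu>t' Tt'"
  shows "\<exists>h \<in> rota_baxter_leibniz_algebra.H2 scale \<mu> T.
           infinitesimal \<mu>t Tt \<in> h \<and> infinitesimal \<mu>t' Tt' \<in> h"
proof -
  interpret rota_baxter_leibniz_algebra scale \<mu> T by (fact assms(2))
  show ?thesis
    using assms(3-5) by (intro H2_classI infinitesimal_in_Z2 infinitesimal_diff_in_B2)
qed

end
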